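(* The parameter tiling $T$ is a factor of a substitution tiling on the four-state alphabet $\mathcal{A}=\{(1,1),(1,0),(0,1),(0,0)\}$, in the following sense. Let $\sigma(1)=1011$ and $\sigma(0)=1010$, and define the constant-length $4\times4$ block substitution $\Sigma$ on $\mathcal{A}$ by $$\Sigma(a,b)_{ij}=\bigl(\sigma(a)_i,\sigma(b)_j\bigr),\qquad (a,b)\in\mathcal{A},\ 1\le i,j\le 4.$$ Define $\psi:\mathcal{A}\to\{0,1\}$ by $\psi(1,1)=\psi(0,0)=0$ and $\psi(1,0)=\psi(0,1)=1$. Then $T$ is obtained by applying $\psi$ entrywise to the substitution tiling $W:\mathbb{N}^2\to\mathcal{A}$ generated by $\Sigma$; that is, $T(x,y)=\psi(W(x,y))$ for all $(x,y)\in\mathbb{N}^2$.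
   Context: $\mathbb{N}$ denotes the positive integers. $V$ is the set of positive integers whose last non-zero digit in base $4$ is $1$ or $3$, and $D=\mathbb{N}\setminus V$. The function $c:\mathbb{N}\to\{0,1\}$ is $c(n)=1$ if $n\in V$ and $c(n)=0$ if $n\in D$. The parameter tiling $T:\mathbb{N}^2\to\{0,1\}$ is defined by $T(x,y)=1$ if $c(x)\neq c(y)$ and $T(x,y)=0$ if $c(x)=c(y)$. $\sigma(a)_i$ denotes the $i$-th letter of the word $\sigma(a)$. The substitution $\Sigma$ acts on an array $U$ over $\mathcal{A}$ (indexed by $\mathbb{N}^2$ or by $\{1,\dots,N\}^2$) by $(\Sigma U)(4(x-1)+i,4(y-1)+j)=\Sigma(U(x,y))_{ij}$ for $1\le i,j\le4$. The substitution tiling $W$ generated by $\Sigma$ is the array $W:\mathbb{N}^2\to\mathcal{A}$ fixed by $\Sigma$ (i.e. $\Sigma W=W$), whose restriction to $\{1,\dots,4^n\}^2$ is $\Sigma^n$ applied to the single letter $(1,1)$, for every $n\geq 0$. *)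

theory Defs
  imports "HOL-Library.Z2"
begin

text \<open>
  The symbols 0 and 1 are the two elements of the type \<^typ>\<open>bit\<close>; its arithmetic is not used.
  The positive integers are the elements of \<^typ>\<open>nat\<close> that are at least 1.
\<close>

definition digit4 :: "nat \<Rightarrow> nat \<Rightarrow> nat" where
  "digit4 n k = n div 4 ^ k mod 4"

text \<open>The value at \<open>n = 0\<close>, which has no non-zero digit, is irrelevant.\<close>

definition last_nonzero_digit4 :: "nat \<Rightarrow> nat" where
  "last_nonzero_digit4 n = digit4 n (LEAST k. digit4 n k \<noteq> 0)"

definition V :: "nat set" where
  "V = {n. n \<ge> 1 \<and> last_nonzero_digit4 n \<in> {1, 3}}"

definition D :: "nat set" where
  "D = {1..} - V"

definition c :: "nat \<Rightarrow> bit" where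
  "c n = (if n \<in> V then 1 else 0)"

lemma c_on_V: "n \<in> V \<Longrightarrow> c n = 1"
  and c_on_D: "n \<in> D \<Longrightarrow> c n = 0"
  by (simp_all add: c_def D_def)

definition parameter_tiling :: "nat \<Rightarrow> nat \<Rightarrow> bit" where
  "parameter_tiling x y = (if c x \<noteq> c y then 1 else 0)"

text \<open>
  An array over \<open>'a\<close> is a partial map on pairs of positive integers whose domain is its index set,
  so that infinite arrays and arrays indexed by \<open>{1..N} \<times> {1..N}\<close> have the same type.
  Rows and columns are numbered from 1.
\<close>

type_synonym 'a array = "nat \<times> nat \<rightharpoonup> 'a"

text \<open>
  A \<open>4 \<times> 4\<close> block substitution \<open>S\<close> sends a letter \<open>a\<close> to the block with entries \<open>S a i j\<close>,
  where \<open>1 \<le> i, j \<le> 4\<close>.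
\<close>

type_synonym 'a block_substitution = "'a \<Rightarrow> nat \<Rightarrow> nat \<Rightarrow> 'a"

text \<open>
  A positive integer is uniquely \<open>4 * (x - 1) + i\<close> with \<open>x \<ge> 1\<close> and \<open>1 \<le> i \<le> 4\<close>;
  the two functions return \<open>x\<close> and \<open>i\<close>.
\<close>

definition block_index :: "nat \<Rightarrow> nat" where
  "block_index m = (m - 1) div 4 + 1"

definition block_offset :: "nat \<Rightarrow> nat" where
  "block_offset m = (m - 1) mod 4 + 1"

definition substitute :: "'a block_substitution \<Rightarrow> 'a array \<Rightarrow> 'a array" where
  "substitute S U = (\<lambda>(m, n). if m \<ge> 1 \<and> n \<ge> 1
     then map_option (\<lambda>a. S a (block_offset m) (block_offset n)) (U (block_index m, block_index n))
     else None)"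

lemma substitute_block:
  assumes "x \<ge> 1" "y \<ge> 1" "i \<in> {1..4}" "j \<in> {1..4}"
  shows "substitute S U (4 * (x - 1) + i, 4 * (y - 1) + j) = map_option (\<lambda>a. S a i j) (U (x, y))"
proof -
  have "block_index (4 * (z - 1) + k) = z \<and> block_offset (4 * (z - 1) + k) = k"
    if z: "z \<ge> 1" and k: "k \<in> {1..4}" for z k :: nat
  proof -
    obtain k' where k': "k = Suc k'" "k' < 4"
      using k by (cases k) auto
    obtain z' where z': "z = Suc z'"
      using z by (cases z) auto
    show ?thesis
      using k' by (simp add: block_index_def block_offset_def z')
  qed
  with assms show ?thesis
    by (simp add: substitute_def)
qed

definition generated_tiling :: "'a block_substitution \<Rightarrow> 'a \<Rightarrow> 'a array \<Rightarrow> bool" where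
  "generated_tiling S a W \<longleftrightarrow>
     dom W = {1..} \<times> {1..} \<and>
     substitute S W = W \<and>
     (\<forall>n. W |` ({1..4 ^ n} \<times> {1..4 ^ n}) = (substitute S ^^ n) [(1, 1) \<mapsto> a])"

type_synonym letter = "bit \<times> bit"

lemma letter_UNIV: "(UNIV :: letter set) = {(1, 1), (1, 0), (0, 1), (0, 0)}"
proof -
  have "p \<in> {(1, 1), (1, 0), (0, 1), (0, 0)}" for p :: letter
    by (cases p; cases "fst p"; cases "snd p") simp_all
  then show ?thesis by blast
qed

definition sigma :: "bit \<Rightarrow> bit list" where
  "sigma a = (if a = 1 then [1, 0, 1, 1] else [1, 0, 1, 0])"

text \<open>List positions are numbered from 0, letters of a word from 1.\<close>

definition Sigma_subst :: "letter block_substitution" where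
  "Sigma_subst = (\<lambda>(a, b) i j. (sigma a ! (i - 1), sigma b ! (j - 1)))"

definition psi :: "letter \<Rightarrow> bit" where
  "psi p = (if p \<in> {(1, 0), (0, 1)} then 1 else 0)"

end

theory Submission
  imports Defs
begin

text \<open>
  Deleting a final zero in base 4 does not change the last non-zero digit. So \<open>c (4 * n) = c n\<close>,
  while on the residue classes 1, 2, 3 modulo 4 the value of \<open>c\<close> is 1, 0, 1. This says exactly that
  the word \<open>c 1, c 2, \<dots>\<close> is a fixed point of \<open>sigma\<close> (\<open>c_eq_sigma\<close>). As \<open>Sigma_subst\<close> acts by
  \<open>sigma\<close> on each coordinate separately, the array of pairs \<open>(c x, c y)\<close> is a fixed point of
  \<open>Sigma_subst\<close>, with the letter \<open>(1, 1)\<close> in its corner.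

  A block substitution commutes with restriction to initial squares, if the side of the square is
  multiplied by 4 (\<open>substitute_restrict\<close>). Hence a fixed point is generated by its corner letter
  (\<open>generated_tiling_fixed_point\<close>), and since the initial squares exhaust the quadrant there is
  only one generated tiling (\<open>generated_tiling_unique\<close>). It is therefore the array of pairs
  \<open>(c x, c y)\<close>, on which \<open>psi\<close> tests whether \<open>c x\<close> and \<open>c y\<close> differ.
\<close>

lemma last_nonzero_digit4_mod:
  assumes "n mod 4 \<noteq> 0"
  shows "last_nonzero_digit4 n = n mod 4"
proof -
  have "(LEAST k. digit4 n k \<noteq> 0) = 0"
    using assms by (intro Least_eq_0) (simp add: digit4_def)
  then show ?thesis
    by (simp add: last_nonzero_digit4_def digit4_def)
qed

lemma digit4_times_4: "digit4 (4 * n) (Suc k) = digit4 n k"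
  by (simp add: digit4_def div_mult2_eq)

text \<open>
  \<open>LEAST\<close> is determined only if some digit is non-zero, which is why positive numbers need this
  fact before digits can be shifted.
\<close>

lemma ex_nonzero_digit4: "n \<ge> 1 \<Longrightarrow> \<exists>k. digit4 n k \<noteq> 0"
proof (induction n rule: less_induct)
  case (less n)
  show ?case
  proof (cases "n mod 4 = 0")
    case False
    then have "digit4 n 0 \<noteq> 0"
      by (simp add: digit4_def)
    then show ?thesis by blast
  next
    case True
    then obtain m where m: "n = 4 * m" by auto
    then have "m < n" "m \<ge> 1"
      using less.prems by simp_all
    then obtain k where "digit4 m k \<noteq> 0"
      using less.IH by blast
    then have "digit4 n (Suc k) \<noteq> 0"
      by (simp add: m digit4_times_4)
    then show ?thesis by blast
  qed
qed

lemma last_nonzero_digit4_times_4: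
  assumes "n \<ge> 1"
  shows "last_nonzero_digit4 (4 * n) = last_nonzero_digit4 n"
proof -
  obtain k where k: "digit4 n k \<noteq> 0"
    using ex_nonzero_digit4[OF assms] by blast
  have "(LEAST k. digit4 (4 * n) k \<noteq> 0) = Suc (LEAST k. digit4 (4 * n) (Suc k) \<noteq> 0)"
  proof (rule Least_Suc)
    show "digit4 (4 * n) (Suc k) \<noteq> 0"
      using k by (simp add: digit4_times_4)
    show "\<not> digit4 (4 * n) 0 \<noteq> 0"
      by (simp add: digit4_def)
  qed
  then show ?thesis
    by (simp add: last_nonzero_digit4_def digit4_times_4)
qed

lemma c_times_4: "n \<ge> 1 \<Longrightarrow> c (4 * n) = c n"
  by (simp add: c_def V_def last_nonzero_digit4_times_4)

lemma c_mod: "n mod 4 \<noteq> 0 \<Longrightarrow> c n = (if n mod 4 = 2 then 0 else 1)"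
proof -
  assume n: "n mod 4 \<noteq> 0"
  then have "n \<ge> 1" by (cases n) simp_all
  moreover have "n mod 4 = 1 \<or> n mod 4 = 2 \<or> n mod 4 = 3"
    using n by linarith
  ultimately show ?thesis
    using last_nonzero_digit4_mod[OF n] by (auto simp: c_def V_def)
qed

text \<open>
  The first three letters \<open>1, 0, 1\<close> of both words \<open>sigma a\<close> come from the non-zero residues
  modulo 4; the fourth letter is \<open>a\<close> itself, because the last position of a block is four times
  the index of the block.
\<close>

lemma c_eq_sigma:
  assumes "m \<ge> 1"
  shows "sigma (c (block_index m)) ! (block_offset m - 1) = c m"
proof -
  define q r where "q = (m - 1) div 4" and "r = (m - 1) mod 4"
  have m: "m = 4 * q + r + 1"
    using assms by (simp add: q_def r_def)
  have idx: "block_index m = q + 1" "block_offset m = Suc r"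
    by (simp_all add: block_index_def block_offset_def q_def r_def)
  have "r < 4" by (simp add: r_def)
  then consider "r < 3" | "r = 3" by linarith
  then show ?thesis
  proof cases
    case 1
    then have mod: "m mod 4 = r + 1"
      by (simp add: m mod_Suc)
    then have "c m = (if r = 1 then 0 else 1)"
      by (subst c_mod) simp_all
    moreover have "r = 0 \<or> r = 1 \<or> r = 2"
      using 1 by linarith
    ultimately show ?thesis
      by (auto simp: idx sigma_def numeral_2_eq_2)
  next
    case 2
    then have "m = 4 * (q + 1)"
      by (simp add: m)
    then have "c m = c (q + 1)"
      using c_times_4[of "q + 1"] by simp
    then show ?thesis
      by (simp add: 2 idx sigma_def numeral_3_eq_3)
  qed
qed

text \<open>
  Position \<open>m\<close> lies among the first \<open>4 * N\<close> positions exactly if its block is among the first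
  \<open>N\<close> blocks.
\<close>

lemma substitute_restrict:
  "substitute S (U |` ({1..N} \<times> {1..N})) = substitute S U |` ({1..4 * N} \<times> {1..4 * N})"
proof -
  have block: "block_index m \<le> N \<longleftrightarrow> m \<le> 4 * N" if "m \<ge> 1" for m
    using that unfolding block_index_def by linarith
  have "1 \<le> block_index m" for m
    by (simp add: block_index_def)
  then show ?thesis
    by (simp add: substitute_def restrict_map_def fun_eq_iff block del: One_nat_def)
qed

lemma generated_tiling_fixed_point:
  assumes dom: "dom W = {1..} \<times> {1..}"
    and fixed: "substitute S W = W"
    and corner: "W (1, 1) = Some a"
  shows "generated_tiling S a W"
proof -
  have "W |` ({1..4 ^ n} \<times> {1..4 ^ n}) = (substitute S ^^ n) [(1, 1) \<mapsto> a]" for n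
  proof (induction n)
    case 0
    show ?case
      using corner by (auto simp: restrict_map_def fun_eq_iff)
  next
    case (Suc n)
    have "W |` ({1..4 ^ Suc n} \<times> {1..4 ^ Suc n})
        = substitute S (W |` ({1..4 ^ n} \<times> {1..4 ^ n}))"
      by (simp only: substitute_restrict fixed power_Suc)
    then show ?case
      by (simp only: Suc funpow.simps o_apply)
  qed
  with dom fixed show ?thesis
    by (simp add: generated_tiling_def)
qed

lemma generated_tiling_unique:
  assumes W: "generated_tiling S a W" and W': "generated_tiling S a W'"
  shows "W = W'"
proof
  fix p
  show "W p = W' p"
  proof (cases "p \<in> {1..} \<times> {1..}")
    case False
    then have "p \<notin> dom W" "p \<notin> dom W'"
      using W W' by (auto simp: generated_tiling_def)
    then show ?thesis
      by (simp add: domIff)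
  next
    case True
    define n where "n = max (fst p) (snd p)"
    define Q where "Q = {1..4 ^ n :: nat} \<times> {1..4 ^ n :: nat}"
    have "n \<le> 4 ^ n"
      by (rule less_imp_le) (rule less_exp[THEN less_le_trans], simp add: power_mono)
    then have "p \<in> Q"
      using True by (cases p) (auto simp: n_def Q_def)
    moreover have "W |` Q = W' |` Q"
      using W W' by (simp add: generated_tiling_def Q_def)
    ultimately show ?thesis
      by (metis restrict_in)
  qed
qed

definition pair_tiling :: "letter array" where
  "pair_tiling = (\<lambda>(x, y). if x \<ge> 1 \<and> y \<ge> 1 then Some (c x, c y) else None)"

lemma generated_pair_tiling: "generated_tiling Sigma_subst (1, 1) pair_tiling"
proof (rule generated_tiling_fixed_point)
  show "dom pair_tiling = {1..} \<times> {1..}"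
    by (auto simp: pair_tiling_def split: if_splits)
  show "pair_tiling (1, 1) = Some (1, 1)"
    by (simp add: pair_tiling_def c_mod)
  have "1 \<le> block_index m" for m
    by (simp add: block_index_def)
  then show "substitute Sigma_subst pair_tiling = pair_tiling"
    using c_eq_sigma by (auto simp: fun_eq_iff substitute_def pair_tiling_def Sigma_subst_def)
qed

lemma psi_pair: "psi (a, b) = (if a \<noteq> b then 1 else 0)"
  by (cases a; cases b) (simp_all add: psi_def)

theorem corollary4p9:
  shows "(\<exists>!W. generated_tiling Sigma_subst (1, 1) W) \<and>
    (\<forall>W. generated_tiling Sigma_subst (1, 1) W \<longrightarrow>
      (\<forall>x\<ge>1. \<forall>y\<ge>1. map_option psi (W (x, y)) = Some (parameter_tiling x y)))"
proof -
  have unique: "W = pair_tiling" if "generated_tiling Sigma_subst (1, 1) W" for W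
    using that generated_pair_tiling by (rule generated_tiling_unique)
  have "map_option psi (pair_tiling (x, y)) = Some (parameter_tiling x y)"
    if "x \<ge> 1" "y \<ge> 1" for x y
    using that by (simp add: pair_tiling_def parameter_tiling_def psi_pair)
  with unique generated_pair_tiling show ?thesis
    by blast
qed

end
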